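(* Let $M$ be a compact smooth manifold without boundary. Assume that for $k>\dim(M)/2+1$, the space of Anosov vector fields $\mathrm{An}^k(M)=\mathrm{An}(M)\cap H^k(TM)$ is an open subset of the Hilbert space $H=H^k(TM)$. Equip $\mathrm{An}^k(M)$ with the Riemannian metric $g_X(\cdot,\cdot)=\langle\cdot,\cdot\rangle_{H^k}$ induced by the standard $H^k$ inner product on each tangent space $T_X\mathrm{An}^k(M)\cong H$. Then for any $X\in\mathrm{An}^k(M)$ there exists a neighborhood $U$ of $X$ (in the $H^k$ topology) such that for any $Y\in U$: (i) there exists a unique path $\gamma_{XY}:[0,1]\to\mathrm{An}^k(M)$ of minimal $H^k$-length connecting $X$ to $Y$ within $\mathrm{An}^k(M)$; (ii) this path is the straight line segment in the ambient Hilbert space $H$, given by $\gamma_{XY}(s)=X+s(Y-X)$; (iii) the path $\gamma_{XY}$ depends smoothly on $Y\in U$. The length of this minimizing geodesic is $d_{\mathrm{An},H^k}(X,Y)=\|Y-X\|_{H^k}$.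
   Context: $M$ carries a fixed auxiliary Riemannian metric $g$ with covariant derivative $\nabla$ and volume measure $\mu_g$; $H^k(TM)$ is the Hilbert space of Sobolev $H^k=W^{k,2}$ vector fields on $M$, with $\|Y\|_{H^k}^2=\sum_{j=0}^k\int_M|\nabla^jY|_g^2\,d\mu_g$ and the corresponding inner product $\langle\cdot,\cdot\rangle_{H^k}$. $\mathrm{An}(M)$ is the set of (at least $C^1$) vector fields $X$ on $M$ whose flow $\varphi^t$ is Anosov, i.e. there are a continuous $d\varphi^t$-invariant splitting $TM=E^s\oplus E^u\oplus\mathbb{R}X$, constants $C,\lambda>0$ and a Riemannian metric on $M$ with norm $\|\cdot\|$ such that for all $t>0$, $\|d\varphi^tv\|\le Ce^{-\lambda t}\|v\|$ for $v\in E^s$ and $\|d\varphi^{-t}v\|\le Ce^{-\lambda t}\|v\|$ for $v\in E^u$. The $H^k$-length of a $C^1$ path $X_s$, $s\in[0,1]$, in $\mathrm{An}^k(M)$ is $\int_0^1\|dX_s/ds\|_{H^k}\,ds$, and $d_{\mathrm{An},H^k}(X_0,X_1)$ is the infimum of these lengths over all $C^1$ paths in $\mathrm{An}^k(M)$ from $X_0$ to $X_1$.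
   Formalization: "Unique path of minimal length" is read as unique among constant-speed paths, every other C^1 minimizer being a monotone reparametrization of it; literal uniqueness fails, since X+s^2(Y-X) has the same length. *)

theory Defs
  imports "HOL-Analysis.Analysis"
begin

section \<open>Smooth maps between normed spaces\<close>

text \<open>
  \<open>D [h\<^sub>n, \<dots>, h\<^sub>1] x\<close> is the \<open>n\<close>-th Frechet derivative at \<open>x\<close>, applied to \<open>h\<^sub>1, \<dots>, h\<^sub>n\<close>. The remainder
  estimate is uniform in the directions \<open>hs\<close>, so each derivative is again differentiable in
  operator norm; this matters because the notion is also used on an infinite-dimensional space.
  On a set that is not open (only \<open>{0..1} \<times> U\<close> below) derivatives are taken within the set.
\<close>

definition smooth_on :: "'a::real_normed_vector set \<Rightarrow> ('a \<Rightarrow> 'b::real_normed_vector) \<Rightarrow> bool" where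
  "smooth_on S f \<longleftrightarrow> (\<exists>D :: 'a list \<Rightarrow> 'a \<Rightarrow> 'b. (\<forall>x\<in>S. D [] x = f x) \<and>
     (\<forall>n. \<forall>x\<in>S.
        (\<forall>hs. length hs = n \<longrightarrow> linear (\<lambda>h. D (h # hs) x)) \<and>
        (\<exists>K. \<forall>hs. length hs = n \<longrightarrow> norm (D hs x) \<le> K * prod_list (map norm hs)) \<and>
        (\<forall>\<epsilon>>0. \<exists>\<delta>>0. \<forall>y\<in>S. dist y x < \<delta> \<longrightarrow>
           (\<forall>hs. length hs = n \<longrightarrow>
              norm (D hs y - D hs x - D ((y - x) # hs) x)
                \<le> \<epsilon> * norm (y - x) * prod_list (map norm hs)))))"

definition C1_on :: "'a::real_normed_vector set \<Rightarrow> ('a \<Rightarrow> 'b::real_normed_vector) \<Rightarrow> bool" where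
  "C1_on S f \<longleftrightarrow> (\<exists>D :: 'a \<Rightarrow> 'a \<Rightarrow>\<^sub>L 'b.
     (\<forall>x\<in>S. (f has_derivative blinfun_apply (D x)) (at x)) \<and> continuous_on S D)"

definition partial :: "'n::finite \<Rightarrow> (real^'n \<Rightarrow> real) \<Rightarrow> real^'n \<Rightarrow> real" where
  "partial i f x = frechet_derivative f (at x) (axis i 1)"


section \<open>Manifolds, tangent vectors, vector fields\<close>

text \<open>
  The manifold is the whole type \<open>'a\<close>; its dimension is \<open>CARD('n)\<close>. A chart is a pair of its domain
  and its coordinate map. The atlas need not be maximal.
\<close>

type_synonym ('a, 'n) chart = "'a set \<times> ('a \<Rightarrow> real^'n)"

abbreviation dom_of :: "('a, 'n::finite) chart \<Rightarrow> 'a set" where "dom_of c \<equiv> fst c"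
abbreviation coord :: "('a, 'n::finite) chart \<Rightarrow> 'a \<Rightarrow> real^'n" where "coord c \<equiv> snd c"
abbreviation img_of :: "('a, 'n::finite) chart \<Rightarrow> (real^'n) set" where
  "img_of c \<equiv> coord c ` dom_of c"
abbreviation param :: "('a, 'n::finite) chart \<Rightarrow> real^'n \<Rightarrow> 'a" where
  "param c \<equiv> inv_into (dom_of c) (coord c)"

definition smooth_atlas :: "('a::topological_space, 'n::finite) chart set \<Rightarrow> bool" where
  "smooth_atlas A \<longleftrightarrow>
     (\<Union>c\<in>A. dom_of c) = UNIV \<and>
     (\<forall>c\<in>A. open (dom_of c) \<and> open (img_of c) \<and>
        homeomorphism (dom_of c) (img_of c) (coord c) (param c)) \<and>
     (\<forall>c\<in>A. \<forall>d\<in>A. smooth_on (coord c ` (dom_of c \<inter> dom_of d)) (coord d \<circ> param c))"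

text \<open>
  A tangent vector at \<open>p\<close> is given by its components in all charts around \<open>p\<close>, related by the
  Jacobians of the coordinate changes. Components in charts not containing \<open>p\<close> are set to \<open>0\<close>
  to make the representation unique.
\<close>

type_synonym ('a, 'n) tvec = "('a, 'n) chart \<Rightarrow> real^'n"
type_synonym ('a, 'n) vfield = "'a \<Rightarrow> ('a, 'n) tvec"

definition tangent_space ::
  "('a::topological_space, 'n::finite) chart set \<Rightarrow> 'a \<Rightarrow> ('a, 'n) tvec set" where
  "tangent_space A p = {v.
     (\<forall>c. \<not> (c \<in> A \<and> p \<in> dom_of c) \<longrightarrow> v c = 0) \<and>
     (\<forall>c\<in>A. \<forall>d\<in>A. p \<in> dom_of c \<longrightarrow> p \<in> dom_of d \<longrightarrow>
        v d = frechet_derivative (coord d \<circ> param c) (at (coord c p)) (v c))}"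

definition tadd :: "('a, 'n::finite) tvec \<Rightarrow> ('a, 'n) tvec \<Rightarrow> ('a, 'n) tvec" where
  "tadd v w = (\<lambda>c. v c + w c)"

definition tscale :: "real \<Rightarrow> ('a, 'n::finite) tvec \<Rightarrow> ('a, 'n) tvec" where
  "tscale r v = (\<lambda>c. r *\<^sub>R v c)"

definition tzero :: "('a, 'n::finite) tvec" where
  "tzero = (\<lambda>c. 0)"

text \<open>The tangent vector at \<open>p\<close> whose components in the chart \<open>c\<close> are \<open>u\<close>.\<close>

definition tangent_of ::
  "('a::topological_space, 'n::finite) chart set \<Rightarrow> ('a, 'n) chart \<Rightarrow> 'a \<Rightarrow> real^'n \<Rightarrow> ('a, 'n) tvec"
  where
  "tangent_of A c p u = (\<lambda>d. if d \<in> A \<and> p \<in> dom_of d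
     then frechet_derivative (coord d \<circ> param c) (at (coord c p)) u else 0)"

definition vector_field ::
  "('a::topological_space, 'n::finite) chart set \<Rightarrow> ('a, 'n) vfield \<Rightarrow> bool" where
  "vector_field A Y \<longleftrightarrow> (\<forall>p. Y p \<in> tangent_space A p)"

definition C1_vector_field ::
  "('a::topological_space, 'n::finite) chart set \<Rightarrow> ('a, 'n) vfield \<Rightarrow> bool" where
  "C1_vector_field A Y \<longleftrightarrow>
     vector_field A Y \<and> (\<forall>c\<in>A. C1_on (img_of c) (\<lambda>x. Y (param c x) c))"

text \<open>The differential at \<open>p\<close> of a map \<open>F\<close> of the manifold to itself.\<close>

definition differential ::
  "('a::topological_space, 'n::finite) chart set \<Rightarrow> ('a \<Rightarrow> 'a) \<Rightarrow> 'a \<Rightarrow> ('a, 'n) tvec \<Rightarrow> ('a, 'n) tvec"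
  where
  "differential A F p v =
     (let c = (SOME c. c \<in> A \<and> p \<in> dom_of c)
      in (\<lambda>d. if d \<in> A \<and> F p \<in> dom_of d
            then frechet_derivative (coord d \<circ> F \<circ> param c) (at (coord c p)) (v c) else 0))"


section \<open>Riemannian metrics\<close>

type_synonym ('a, 'n) metric = "'a \<Rightarrow> ('a, 'n) tvec \<Rightarrow> ('a, 'n) tvec \<Rightarrow> real"

definition metric_matrix ::
  "('a::topological_space, 'n::finite) chart set \<Rightarrow> ('a, 'n) metric \<Rightarrow> ('a, 'n) chart
     \<Rightarrow> real^'n \<Rightarrow> real^'n^'n" where
  "metric_matrix A g c x = (\<chi> i j. g (param c x)
     (tangent_of A c (param c x) (axis i 1)) (tangent_of A c (param c x) (axis j 1)))"

definition riemannian_metric ::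
  "('a::topological_space, 'n::finite) chart set \<Rightarrow> ('a, 'n) metric \<Rightarrow> bool" where
  "riemannian_metric A g \<longleftrightarrow>
     (\<forall>p. \<forall>u\<in>tangent_space A p. \<forall>v\<in>tangent_space A p.
        g p u v = g p v u \<and>
        (u \<noteq> tzero \<longrightarrow> g p u u > 0) \<and>
        (\<forall>w\<in>tangent_space A p. \<forall>a b.
           g p (tadd (tscale a u) (tscale b v)) w = a * g p u w + b * g p v w)) \<and>
     (\<forall>c\<in>A. \<forall>i j. smooth_on (img_of c) (\<lambda>x. metric_matrix A g c x $ i $ j))"

definition tnorm :: "('a, 'n::finite) metric \<Rightarrow> 'a \<Rightarrow> ('a, 'n) tvec \<Rightarrow> real" where
  "tnorm g p v = sqrt (g p v v)"

text \<open>The Christoffel symbol with upper index \<open>i\<close> and lower indices \<open>j\<close>, \<open>k\<close> (Levi-Civita).\<close>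

definition christoffel ::
  "('a::topological_space, 'n::finite) chart set \<Rightarrow> ('a, 'n) metric \<Rightarrow> ('a, 'n) chart
     \<Rightarrow> 'n \<Rightarrow> 'n \<Rightarrow> 'n \<Rightarrow> real^'n \<Rightarrow> real" where
  "christoffel A g c i j k x = (1/2) * (\<Sum>l\<in>UNIV. matrix_inv (metric_matrix A g c x) $ i $ l *
     (partial j (\<lambda>y. metric_matrix A g c y $ l $ k) x
      + partial k (\<lambda>y. metric_matrix A g c y $ l $ j) x
      - partial l (\<lambda>y. metric_matrix A g c y $ j $ k) x))"

definition riemannian_volume ::
  "('a::topological_space, 'n::finite) chart set \<Rightarrow> ('a, 'n) metric \<Rightarrow> 'a measure" where
  "riemannian_volume A g = (THE \<mu>. sets \<mu> = sets borel \<and>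
     (\<forall>c\<in>A. \<forall>B\<in>sets borel. B \<subseteq> dom_of c \<longrightarrow>
        emeasure \<mu> B =
          (\<integral>\<^sup>+x\<in>coord c ` B. ennreal (sqrt (det (metric_matrix A g c x))) \<partial>lborel)))"


section \<open>Sobolev vector fields\<close>

definition locally_integrable_on :: "(real^'n::finite) set \<Rightarrow> (real^'n \<Rightarrow> real) \<Rightarrow> bool" where
  "locally_integrable_on \<Omega> f \<longleftrightarrow> (\<forall>K. compact K \<longrightarrow> K \<subseteq> \<Omega> \<longrightarrow> set_integrable lborel K f)"

definition weak_partial ::
  "(real^'n::finite) set \<Rightarrow> 'n \<Rightarrow> (real^'n \<Rightarrow> real) \<Rightarrow> (real^'n \<Rightarrow> real) \<Rightarrow> bool" where
  "weak_partial \<Omega> b f f' \<longleftrightarrow>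
     locally_integrable_on \<Omega> f \<and> locally_integrable_on \<Omega> f' \<and>
     (\<forall>\<eta>. smooth_on UNIV \<eta> \<longrightarrow> compact (closure {x. \<eta> x \<noteq> 0}) \<longrightarrow> closure {x. \<eta> x \<noteq> 0} \<subseteq> \<Omega> \<longrightarrow>
        (LINT x:\<Omega>|lborel. f x * partial b \<eta> x) = - (LINT x:\<Omega>|lborel. f' x * \<eta> x))"

text \<open>
  A field of \<open>TM\<close>-valued tensors of all covariant ranks at once: \<open>T p [v\<^sub>1, \<dots>, v\<^sub>j]\<close> is the value at
  \<open>p\<close> of its rank-\<open>j\<close> part. Its components in a chart \<open>c\<close> carry lower indices \<open>as\<close>, upper index \<open>i\<close>.
\<close>

type_synonym ('a, 'n) tfield = "'a \<Rightarrow> ('a, 'n) tvec list \<Rightarrow> ('a, 'n) tvec"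

definition multilinear_at ::
  "('a::topological_space, 'n::finite) chart set \<Rightarrow> nat \<Rightarrow> 'a
     \<Rightarrow> (('a, 'n) tvec list \<Rightarrow> ('a, 'n) tvec) \<Rightarrow> bool" where
  "multilinear_at A j p S \<longleftrightarrow>
     (\<forall>vs. length vs = j \<longrightarrow> set vs \<subseteq> tangent_space A p \<longrightarrow> S vs \<in> tangent_space A p) \<and>
     (\<forall>us ws v w a b. length us + 1 + length ws = j \<longrightarrow>
        set us \<union> set ws \<union> {v, w} \<subseteq> tangent_space A p \<longrightarrow>
        S (us @ tadd (tscale a v) (tscale b w) # ws)
          = tadd (tscale a (S (us @ v # ws))) (tscale b (S (us @ w # ws))))"

definition tcomp ::
  "('a::topological_space, 'n::finite) chart set \<Rightarrow> ('a, 'n) tfield \<Rightarrow> ('a, 'n) chart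
     \<Rightarrow> 'n list \<Rightarrow> 'n \<Rightarrow> real^'n \<Rightarrow> real" where
  "tcomp A T c as i x =
     T (param c x) (map (\<lambda>a. tangent_of A c (param c x) (axis a 1)) as) c $ i"

text \<open>
  \<open>T\<close> consists of the weak iterated covariant derivatives \<open>\<nabla>\<^sup>jY\<close>, \<open>j \<le> k\<close>, the new differentiation
  slot coming first. The last conjunct is the coordinate formula
  \<open>(\<nabla>T)\<^bsub>b as\<^esub>\<^sup>i = \<partial>\<^sub>b T\<^bsub>as\<^esub>\<^sup>i + \<Sum>\<^sub>m \<Gamma>\<^sup>i\<^bsub>bm\<^esub> T\<^bsub>as\<^esub>\<^sup>m - \<Sum>\<^sub>r \<Sum>\<^sub>m \<Gamma>\<^sup>m\<^bsub>b as(r)\<^esub> T\<^bsub>as[r:=m]\<^esub>\<^sup>i\<close>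
  solved for the partial derivative, which is taken in the weak sense.
\<close>

definition weak_cov_derivs ::
  "('a::topological_space, 'n::finite) chart set \<Rightarrow> ('a, 'n) metric \<Rightarrow> nat
     \<Rightarrow> ('a, 'n) vfield \<Rightarrow> ('a, 'n) tfield \<Rightarrow> bool" where
  "weak_cov_derivs A g k Y T \<longleftrightarrow>
     (\<forall>p. T p [] = Y p) \<and>
     (\<forall>p. \<forall>j\<le>k. multilinear_at A j p (T p)) \<and>
     (\<forall>c\<in>A. \<forall>as i. length as \<le> k \<longrightarrow> locally_integrable_on (img_of c) (tcomp A T c as i)) \<and>
     (\<forall>c\<in>A. \<forall>as i b. length as < k \<longrightarrow>
        weak_partial (img_of c) b (tcomp A T c as i)
          (\<lambda>x. tcomp A T c (b # as) i x
               - (\<Sum>m\<in>UNIV. christoffel A g c i b m x * tcomp A T c as m x)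
               + (\<Sum>r<length as. \<Sum>m\<in>UNIV.
                    christoffel A g c m b (as ! r) x * tcomp A T c (as[r := m]) i x)))"

definition orthonormal_frame ::
  "('a::topological_space, 'n::finite) chart set \<Rightarrow> ('a, 'n) metric \<Rightarrow> 'a \<Rightarrow> 'n \<Rightarrow> ('a, 'n) tvec" where
  "orthonormal_frame A g p = (SOME e. (\<forall>i. e i \<in> tangent_space A p) \<and>
     (\<forall>i j. g p (e i) (e j) = (if i = j then 1 else 0)))"

text \<open>The inner product induced by \<open>g\<close> on the rank-\<open>j\<close> tensors at \<open>p\<close>; it does not depend on the frame.\<close>

definition tensor_inner ::
  "('a::topological_space, 'n::finite) chart set \<Rightarrow> ('a, 'n) metric \<Rightarrow> nat \<Rightarrow> 'a
     \<Rightarrow> (('a, 'n) tvec list \<Rightarrow> ('a, 'n) tvec) \<Rightarrow> (('a, 'n) tvec list \<Rightarrow> ('a, 'n) tvec) \<Rightarrow> real" where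
  "tensor_inner A g j p S T = (\<Sum>as | length as = j.
     g p (S (map (orthonormal_frame A g p) as)) (T (map (orthonormal_frame A g p) as)))"

definition Hk_fields ::
  "('a::topological_space, 'n::finite) chart set \<Rightarrow> ('a, 'n) metric \<Rightarrow> nat \<Rightarrow> ('a, 'n) vfield set"
  where
  "Hk_fields A g k = {Y. vector_field A Y \<and> (\<exists>T. weak_cov_derivs A g k Y T \<and>
     (\<forall>j\<le>k. integrable (riemannian_volume A g) (\<lambda>p. tensor_inner A g j p (T p) (T p))))}"

text \<open>The weak derivatives are unique up to null sets, so the choice does not affect integrals.\<close>

definition cov_derivs ::
  "('a::topological_space, 'n::finite) chart set \<Rightarrow> ('a, 'n) metric \<Rightarrow> nat
     \<Rightarrow> ('a, 'n) vfield \<Rightarrow> ('a, 'n) tfield" where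
  "cov_derivs A g k Y = (SOME T. weak_cov_derivs A g k Y T)"

definition Hk_inner ::
  "('a::topological_space, 'n::finite) chart set \<Rightarrow> ('a, 'n) metric \<Rightarrow> nat
     \<Rightarrow> ('a, 'n) vfield \<Rightarrow> ('a, 'n) vfield \<Rightarrow> real" where
  "Hk_inner A g k Y Z = (\<Sum>j\<le>k. LINT p|riemannian_volume A g.
     tensor_inner A g j p (cov_derivs A g k Y p) (cov_derivs A g k Z p))"

text \<open>
  The Hilbert space \<open>H\<^sup>k(TM)\<close> consists of the classes of \<open>H\<^sup>k\<close> fields modulo equality almost
  everywhere. A HOL type cannot depend on the terms \<open>A\<close>, \<open>g\<close>, \<open>k\<close>, so the quotient is described by
  its class map \<open>cls\<close> onto a Hilbert space type \<open>'h\<close>; this determines \<open>'h\<close> up to isometric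
  isomorphism. Values of \<open>cls\<close> on other fields are irrelevant.
\<close>

definition Hk_space ::
  "('a::topological_space, 'n::finite) chart set \<Rightarrow> ('a, 'n) metric \<Rightarrow> nat
     \<Rightarrow> (('a, 'n) vfield \<Rightarrow> 'h::{real_inner, complete_space}) \<Rightarrow> bool" where
  "Hk_space A g k cls \<longleftrightarrow>
     cls ` Hk_fields A g k = UNIV \<and>
     (\<forall>Y\<in>Hk_fields A g k. \<forall>Z\<in>Hk_fields A g k.
        (cls Y = cls Z \<longleftrightarrow> (AE p in riemannian_volume A g. Y p = Z p)) \<and>
        cls (\<lambda>p. tadd (Y p) (Z p)) = cls Y + cls Z \<and>
        (\<forall>r. cls (\<lambda>p. tscale r (Y p)) = r *\<^sub>R cls Y) \<and>
        inner (cls Y) (cls Z) = Hk_inner A g k Y Z)"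


section \<open>Anosov vector fields\<close>

definition is_flow ::
  "('a::topological_space, 'n::finite) chart set \<Rightarrow> ('a, 'n) vfield \<Rightarrow> (real \<Rightarrow> 'a \<Rightarrow> 'a) \<Rightarrow> bool" where
  "is_flow A X \<phi> \<longleftrightarrow> (\<forall>p. \<phi> 0 p = p \<and> continuous_on UNIV (\<lambda>t. \<phi> t p) \<and>
     (\<forall>t. \<forall>c\<in>A. \<phi> t p \<in> dom_of c \<longrightarrow>
        ((\<lambda>s. coord c (\<phi> s p)) has_vector_derivative X (\<phi> t p) c) (at t)))"

definition lin_comb :: "nat \<Rightarrow> (nat \<Rightarrow> real) \<Rightarrow> (nat \<Rightarrow> ('a, 'n::finite) tvec) \<Rightarrow> ('a, 'n) tvec" where
  "lin_comb m r e = (\<lambda>c. \<Sum>i<m. r i *\<^sub>R e i c)"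

definition continuous_subbundle ::
  "('a::topological_space, 'n::finite) chart set \<Rightarrow> ('a \<Rightarrow> ('a, 'n) tvec set) \<Rightarrow> bool" where
  "continuous_subbundle A E \<longleftrightarrow> (\<forall>p. \<exists>V m. \<exists>e :: nat \<Rightarrow> ('a, 'n) vfield. open V \<and> p \<in> V \<and>
     (\<forall>i<m. (\<forall>q\<in>V. e i q \<in> tangent_space A q) \<and>
        (\<forall>c\<in>A. continuous_on (V \<inter> dom_of c) (\<lambda>q. e i q c))) \<and>
     (\<forall>q\<in>V. E q = {lin_comb m r (\<lambda>i. e i q) | r. True} \<and>
        (\<forall>r. lin_comb m r (\<lambda>i. e i q) = tzero \<longrightarrow> (\<forall>i<m. r i = 0))))"

definition anosov_flow ::
  "('a::topological_space, 'n::finite) chart set \<Rightarrow> ('a, 'n) vfield \<Rightarrow> (real \<Rightarrow> 'a \<Rightarrow> 'a) \<Rightarrow> bool" where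
  "anosov_flow A X \<phi> \<longleftrightarrow> (\<exists>Es Eu C lam h.
     continuous_subbundle A Es \<and> continuous_subbundle A Eu \<and>
     (\<forall>p. \<forall>v\<in>tangent_space A p.
        \<exists>!(u, w, z). u \<in> Es p \<and> w \<in> Eu p \<and> z \<in> range (\<lambda>r. tscale r (X p)) \<and>
          v = tadd u (tadd w z)) \<and>
     (\<forall>t p. differential A (\<phi> t) p ` Es p = Es (\<phi> t p) \<and>
            differential A (\<phi> t) p ` Eu p = Eu (\<phi> t p)) \<and>
     C > 0 \<and> lam > 0 \<and> riemannian_metric A h \<and>
     (\<forall>t>0. \<forall>p.
        (\<forall>v\<in>Es p. tnorm h (\<phi> t p) (differential A (\<phi> t) p v) \<le> C * exp (- lam * t) * tnorm h p v) \<and>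
        (\<forall>v\<in>Eu p. tnorm h (\<phi> (- t) p) (differential A (\<phi> (- t)) p v)
                     \<le> C * exp (- lam * t) * tnorm h p v)))"

definition An :: "('a::topological_space, 'n::finite) chart set \<Rightarrow> ('a, 'n) vfield set" where
  "An A = {X. C1_vector_field A X \<and> (\<exists>\<phi>. is_flow A X \<phi> \<and> anosov_flow A X \<phi>)}"

definition An_Hk ::
  "('a::topological_space, 'n::finite) chart set \<Rightarrow> ('a, 'n) metric \<Rightarrow> nat
     \<Rightarrow> (('a, 'n) vfield \<Rightarrow> 'h::{real_inner, complete_space}) \<Rightarrow> 'h set" where
  "An_Hk A g k cls = cls ` (An A \<inter> Hk_fields A g k)"


section \<open>Paths, lengths, distance\<close>

text \<open>
  Only the values of a path on \<open>{0..1}\<close> matter. A Riemannian metric on an open subset of \<open>'h\<close> is a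
  function \<open>G\<close> assigning to a point a bilinear form on its tangent space \<open>'h\<close>.
\<close>

definition C1_path :: "(real \<Rightarrow> 'b::real_normed_vector) \<Rightarrow> bool" where
  "C1_path \<gamma> \<longleftrightarrow> (\<exists>D. (\<forall>s\<in>{0..1}. (\<gamma> has_vector_derivative D s) (at s within {0..1})) \<and>
     continuous_on {0..1} D)"

definition velocity :: "(real \<Rightarrow> 'b::real_normed_vector) \<Rightarrow> real \<Rightarrow> 'b" where
  "velocity \<gamma> s = vector_derivative \<gamma> (at s within {0..1})"

definition speed :: "('h \<Rightarrow> 'h \<Rightarrow> 'h \<Rightarrow> real) \<Rightarrow> (real \<Rightarrow> 'h::real_normed_vector) \<Rightarrow> real \<Rightarrow> real" where
  "speed G \<gamma> s = sqrt (G (\<gamma> s) (velocity \<gamma> s) (velocity \<gamma> s))"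

definition path_len :: "('h \<Rightarrow> 'h \<Rightarrow> 'h \<Rightarrow> real) \<Rightarrow> (real \<Rightarrow> 'h::real_normed_vector) \<Rightarrow> real" where
  "path_len G \<gamma> = integral {0..1} (speed G \<gamma>)"

definition paths_between :: "'h::real_normed_vector set \<Rightarrow> 'h \<Rightarrow> 'h \<Rightarrow> (real \<Rightarrow> 'h) set" where
  "paths_between S X Y = {\<gamma>. C1_path \<gamma> \<and> (\<forall>s\<in>{0..1}. \<gamma> s \<in> S) \<and> \<gamma> 0 = X \<and> \<gamma> 1 = Y}"

definition path_dist ::
  "('h \<Rightarrow> 'h \<Rightarrow> 'h \<Rightarrow> real) \<Rightarrow> 'h::real_normed_vector set \<Rightarrow> 'h \<Rightarrow> 'h \<Rightarrow> ereal" where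
  "path_dist G S X Y = (INF \<gamma>\<in>paths_between S X Y. ereal (path_len G \<gamma>))"

definition minimal_path ::
  "('h \<Rightarrow> 'h \<Rightarrow> 'h \<Rightarrow> real) \<Rightarrow> 'h::real_normed_vector set \<Rightarrow> 'h \<Rightarrow> 'h \<Rightarrow> (real \<Rightarrow> 'h) \<Rightarrow> bool" where
  "minimal_path G S X Y \<gamma> \<longleftrightarrow> \<gamma> \<in> paths_between S X Y \<and>
     (\<forall>\<delta>\<in>paths_between S X Y. path_len G \<gamma> \<le> path_len G \<delta>)"

definition constant_speed ::
  "('h \<Rightarrow> 'h \<Rightarrow> 'h \<Rightarrow> real) \<Rightarrow> (real \<Rightarrow> 'h::real_normed_vector) \<Rightarrow> bool" where
  "constant_speed G \<gamma> \<longleftrightarrow> (\<exists>v. \<forall>s\<in>{0..1}. speed G \<gamma> s = v)"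

definition reparametrization_of ::
  "(real \<Rightarrow> 'h::real_normed_vector) \<Rightarrow> (real \<Rightarrow> 'h) \<Rightarrow> bool" where
  "reparametrization_of \<delta> \<gamma> \<longleftrightarrow> (\<exists>\<theta> :: real \<Rightarrow> real. C1_path \<theta> \<and> mono_on {0..1} \<theta> \<and>
     \<theta> 0 = 0 \<and> \<theta> 1 = 1 \<and> (\<forall>s\<in>{0..1}. \<delta> s = \<gamma> (\<theta> s)))"

text \<open>
  Length does not change under reparametrization, so "the unique path of minimal length" means:
  unique up to reparametrization, and unique as a map once the speed is required to be constant.
\<close>

definition unique_minimal_path ::
  "('h \<Rightarrow> 'h \<Rightarrow> 'h \<Rightarrow> real) \<Rightarrow> 'h::real_normed_vector set \<Rightarrow> 'h \<Rightarrow> 'h \<Rightarrow> (real \<Rightarrow> 'h) \<Rightarrow> bool" where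
  "unique_minimal_path G S X Y \<gamma> \<longleftrightarrow>
     minimal_path G S X Y \<gamma> \<and> constant_speed G \<gamma> \<and>
     (\<forall>\<delta>. minimal_path G S X Y \<delta> \<longrightarrow> reparametrization_of \<delta> \<gamma> \<and>
        (constant_speed G \<delta> \<longrightarrow> (\<forall>s\<in>{0..1}. \<delta> s = \<gamma> s)))"

definition Hk_metric :: "'h::real_inner \<Rightarrow> 'h \<Rightarrow> 'h \<Rightarrow> real" where
  "Hk_metric X u v = inner u v"

end

theory Submission
  imports Defs
begin

text \<open>
  The metric on the open set of Anosov fields is the ambient inner product, the same at every point,
  so this is a flat open subset \<open>S\<close> of a Hilbert space. As \<open>U\<close> serves any ball around \<open>X\<close> inside
  \<open>S\<close>: balls are convex, so the segment from \<open>X\<close> to a point \<open>Y\<close> of the ball stays in \<open>S\<close>.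

  Let \<open>d = Y - X \<noteq> 0\<close>; for \<open>Y = X\<close> a path of length zero is constant. For a \<open>C\<^sup>1\<close> path with velocity \<open>v\<close>, integrating \<open>\<langle>v, d\<rangle> \<le> \<parallel>v\<parallel> \<parallel>d\<parallel>\<close> gives
  \<open>\<parallel>d\<parallel>\<^sup>2 \<le> \<parallel>d\<parallel> \<cdot> length\<close>, and the segment attains the bound. For a path that attains it, the
  integrand \<open>\<parallel>v\<parallel> \<parallel>d\<parallel> - \<langle>v, d\<rangle>\<close> is continuous, nonnegative and has integral zero, hence vanishes, and
  the equality case of Cauchy-Schwarz makes \<open>v\<close> a nonnegative multiple of \<open>d\<close> at each time
  (\<open>velocity_of_shortest_path\<close>). So the path runs monotonically along the segment; with constant
  speed, it is the segment.

  Smoothness in \<open>(s, Y)\<close> holds because \<open>X + s (Y - X)\<close> is a continuous polynomial of degree two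
  (\<open>smooth_on_quadratic\<close>).
\<close>

section \<open>Continuous quadratic maps are smooth\<close>

text \<open>
  The Taylor expansion of a quadratic map is exact after the second order: the first-order remainder
  is \<open>B (y - x) (y - x)\<close>, the remainder of the first derivative is zero, and the second derivative is
  constant. This provides the whole family of derivatives explicitly.
\<close>

lemma smooth_on_quadratic:
  fixes L :: "'a::real_normed_vector \<Rightarrow> 'b::real_normed_vector" and B :: "'a \<Rightarrow> 'a \<Rightarrow> 'b"
  assumes L: "bounded_linear L" and B: "bounded_bilinear B"
  shows "smooth_on S (\<lambda>x. a + L x + B x x)"
proof -
  interpret L: bounded_linear L by (rule L)
  interpret B: bounded_bilinear B by (rule B)
  obtain KL where KL: "\<And>x. norm (L x) \<le> norm x * KL"
    using L.nonneg_bounded by blast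
  obtain KB where KB0: "0 \<le> KB" and KB: "\<And>x y. norm (B x y) \<le> norm x * norm y * KB"
    using B.nonneg_bounded by blast
  define D :: "'a list \<Rightarrow> 'a \<Rightarrow> 'b" where
    "D hs x = (case hs of [] \<Rightarrow> a + L x + B x x
       | [h] \<Rightarrow> L h + (B h x + B x h)
       | [h', h] \<Rightarrow> B h h' + B h' h
       | _ \<Rightarrow> 0)" for hs x
  have D0: "D [] x = a + L x + B x x"
    and D1: "D [h] x = L h + (B h x + B x h)"
    and D2: "D [h', h] x = B h h' + B h' h"
    and D3: "D (h1 # h2 # h3 # hs) x = 0" for x h h' h1 h2 h3 hs
    by (simp_all add: D_def)
  \<comment> \<open>The rule \<open>remdups_adj.cases\<close> is borrowed for its split into lists of length 0, 1 and at least 2.\<close>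
  have linear: "linear (\<lambda>h. D (h # hs) x)" for hs x
  proof (cases hs rule: remdups_adj.cases)
    case 1
    then show ?thesis
      by (intro linearI)
        (simp_all add: D1 L.add L.scaleR B.add_left B.add_right B.scaleR_left B.scaleR_right
          scaleR_add_right)
  next
    case (2 h)
    then show ?thesis
      by (intro linearI)
        (simp_all add: D2 B.add_left B.add_right B.scaleR_left B.scaleR_right scaleR_add_right)
  next
    case (3 h1 h2 hs')
    then show ?thesis
      by (intro linearI) (simp_all add: D3)
  qed
  have bounded: "\<exists>K. \<forall>hs. length hs = n \<longrightarrow> norm (D hs x) \<le> K * prod_list (map norm hs)" for n x
  proof -
    consider "n = 0" | "n = 1" | "n = 2" | m where "n = Suc (Suc (Suc m))"
      by (metis One_nat_def Suc_1 not0_implies_Suc)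
    then show ?thesis
    proof cases
      case 1
      then show ?thesis by (intro exI[of _ "norm (D [] x)"]) simp
    next
      case 2
      have "norm (D [h] x) \<le> (KL + 2 * norm x * KB) * norm h" for h
      proof -
        have "norm (D [h] x) \<le> norm (L h) + (norm (B h x) + norm (B x h))"
          unfolding D1 by (intro norm_triangle_mono order_refl)
        also have "\<dots> \<le> norm h * KL + (norm h * norm x * KB + norm x * norm h * KB)"
          by (intro add_mono KL KB)
        finally show ?thesis by (simp add: algebra_simps)
      qed
      with 2 show ?thesis
        by (intro exI[of _ "KL + 2 * norm x * KB"]) (auto simp: length_Suc_conv)
    next
      case 3
      have "norm (D [h', h] x) \<le> 2 * KB * (norm h' * norm h)" for h' h
      proof -
        have "norm (D [h', h] x) \<le> norm (B h h') + norm (B h' h)"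
          unfolding D2 by (rule norm_triangle_ineq)
        also have "\<dots> \<le> norm h * norm h' * KB + norm h' * norm h * KB"
          by (intro add_mono KB)
        finally show ?thesis by (simp add: algebra_simps)
      qed
      with 3 show ?thesis
        by (intro exI[of _ "2 * KB"]) (auto simp: length_Suc_conv numeral_2_eq_2)
    next
      case 4
      then show ?thesis by (intro exI[of _ 0]) (auto simp: length_Suc_conv D3)
    qed
  qed
  have remainder0: "D [] y - D [] x - D [y - x] x = B (y - x) (y - x)" for x y
    by (simp add: D0 D1 L.diff B.diff_left B.diff_right algebra_simps)
  have remainder: "D hs y - D hs x - D ((y - x) # hs) x = 0" if "hs \<noteq> []" for hs x y
  proof (cases hs rule: remdups_adj.cases)
    case (2 h)
    then show ?thesis
      by (simp add: D1 D2 B.diff_left B.diff_right algebra_simps)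
  next
    case (3 h1 h2 hs')
    then show ?thesis
      by (cases hs') (simp_all add: D2 D3)
  qed (use that in simp)
  have taylor: "\<exists>\<delta>>0. \<forall>y\<in>S. dist y x < \<delta> \<longrightarrow> (\<forall>hs. length hs = n \<longrightarrow>
      norm (D hs y - D hs x - D ((y - x) # hs) x) \<le> \<epsilon> * norm (y - x) * prod_list (map norm hs))"
    if "\<epsilon> > 0" for \<epsilon> :: real and n x
    \<comment> \<open>\<open>KB + 1\<close> rather than \<open>KB\<close>, since \<open>KB\<close> may be zero.\<close>
  proof (intro exI[of _ "\<epsilon> / (KB + 1)"] conjI ballI impI allI)
    show "\<epsilon> / (KB + 1) > 0" using that KB0 by simp
  next
    fix y and hs :: "'a list"
    assume "dist y x < \<epsilon> / (KB + 1)"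
    then have "norm (y - x) * (KB + 1) \<le> \<epsilon>"
      using KB0 by (simp add: dist_norm field_simps)
    then have *: "norm (y - x) * KB \<le> \<epsilon>"
      using norm_ge_zero[of "y - x"] by (simp only: distrib_left mult_1_right)
    show "norm (D hs y - D hs x - D ((y - x) # hs) x) \<le> \<epsilon> * norm (y - x) * prod_list (map norm hs)"
    proof (cases "hs = []")
      case True
      have "norm (B (y - x) (y - x)) \<le> norm (y - x) * KB * norm (y - x)"
        using KB[of "y - x" "y - x"] by (simp add: mult_ac)
      also have "\<dots> \<le> \<epsilon> * norm (y - x)"
        using * by (rule mult_right_mono) simp
      finally show ?thesis using True by (simp add: remainder0)
    next
      case False
      have "0 \<le> prod_list (map norm hs)" by (induction hs) auto
      with False that show ?thesis by (simp add: remainder)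
    qed
  qed
  show ?thesis
    unfolding smooth_on_def
    by (intro exI[of _ D]) (use D0 linear bounded taylor in auto)
qed

text \<open>The relevant bilinear form on \<open>\<real> \<times> 'a\<close> is \<open>((s, y), (t, z)) \<mapsto> s z\<close>.\<close>

lemma smooth_on_segment:
  fixes X :: "'a::real_normed_vector"
  shows "smooth_on S (\<lambda>(s, Y). X + s *\<^sub>R (Y - X))"
proof -
  have "bounded_linear (\<lambda>p::real \<times> 'a. - (fst p *\<^sub>R X))"
    by (intro bounded_linear_minus bounded_linear_scaleR_const bounded_linear_fst)
  moreover have "bounded_bilinear (\<lambda>p q::real \<times> 'a. fst p *\<^sub>R snd q)"
    by (rule bounded_bilinear.comp[OF bounded_bilinear_scaleR bounded_linear_fst bounded_linear_snd])
  ultimately have "smooth_on S (\<lambda>p::real \<times> 'a. X + - (fst p *\<^sub>R X) + fst p *\<^sub>R snd p)"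
    by (rule smooth_on_quadratic)
  moreover have "(\<lambda>p::real \<times> 'a. X + - (fst p *\<^sub>R X) + fst p *\<^sub>R snd p)
      = (\<lambda>(s, Y). X + s *\<^sub>R (Y - X))"
    by (auto simp: fun_eq_iff algebra_simps)
  ultimately show ?thesis by simp
qed

section \<open>Shortest paths in an inner product space\<close>

lemma velocity_eqI:
  assumes "(\<gamma> has_vector_derivative v) (at s within {0..1})" "s \<in> {0..1}"
  shows "velocity \<gamma> s = v"
  unfolding velocity_def
  using vector_derivative_within_cbox[of 0 1 s \<gamma> v] assms by simp

lemma
  assumes "C1_path \<gamma>"
  shows C1_path_velocity:
      "s \<in> {0..1} \<Longrightarrow> (\<gamma> has_vector_derivative velocity \<gamma> s) (at s within {0..1})"
    and continuous_on_velocity: "continuous_on {0..1} (velocity \<gamma>)"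
proof -
  obtain D where D: "\<And>s. s \<in> {0..1} \<Longrightarrow> (\<gamma> has_vector_derivative D s) (at s within {0..1})"
    and cont: "continuous_on {0..1} D"
    using assms unfolding C1_path_def by blast
  have eq: "velocity \<gamma> s = D s" if "s \<in> {0..1}" for s
    using D that by (blast intro: velocity_eqI)
  show "(\<gamma> has_vector_derivative velocity \<gamma> s) (at s within {0..1})" if "s \<in> {0..1}"
    using D[OF that] eq[OF that] by simp
  show "continuous_on {0..1} (velocity \<gamma>)"
    using cont by (subst continuous_on_cong[OF refl eq])
qed

lemma speed_Hk_metric: "speed Hk_metric \<gamma> s = norm (velocity \<gamma> s)"
  by (simp add: speed_def Hk_metric_def norm_eq_sqrt_inner)

lemma has_integral_path_len:
  assumes "C1_path \<gamma>"
  shows "((\<lambda>s. norm (velocity \<gamma> s)) has_integral path_len Hk_metric \<gamma>) {0..1}"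
  unfolding path_len_def speed_Hk_metric
  by (intro integrable_integral integrable_continuous_interval continuous_on_norm
      continuous_on_velocity assms)

text \<open>
  The deficit in the Cauchy-Schwarz inequality between the velocity and the displacement integrates
  to \<open>\<parallel>d\<parallel> (length - \<parallel>d\<parallel>)\<close>, so it measures how far the path is from being shortest.
\<close>

lemma has_integral_cauchy_schwarz_deficit:
  assumes "\<gamma> \<in> paths_between S X Y"
  shows "((\<lambda>s. norm (velocity \<gamma> s) * norm (Y - X) - inner (velocity \<gamma> s) (Y - X))
    has_integral (path_len Hk_metric \<gamma> - norm (Y - X)) * norm (Y - X)) {0..1}"
proof -
  have \<gamma>: "C1_path \<gamma>" "\<gamma> 0 = X" "\<gamma> 1 = Y"
    using assms by (auto simp: paths_between_def)
  have "((\<lambda>s. inner (velocity \<gamma> s) (Y - X)) has_integral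
      inner (\<gamma> 1) (Y - X) - inner (\<gamma> 0) (Y - X)) {0..1}"
    by (intro fundamental_theorem_of_calculus
        bounded_linear.has_vector_derivative[OF bounded_linear_inner_left] C1_path_velocity \<gamma>) auto
  then have "((\<lambda>s. inner (velocity \<gamma> s) (Y - X)) has_integral norm (Y - X) * norm (Y - X)) {0..1}"
    by (simp add: \<gamma> inner_diff_left[symmetric] power2_norm_eq_inner[symmetric] power2_eq_square)
  from has_integral_diff[OF has_integral_mult_left[OF has_integral_path_len[OF \<gamma>(1)]] this]
  show ?thesis by (simp add: left_diff_distrib)
qed

lemma path_len_ge_norm:
  assumes "\<gamma> \<in> paths_between S X Y"
  shows "norm (Y - X) \<le> path_len Hk_metric \<gamma>"
proof (cases "Y = X")
  case True
  have "0 \<le> path_len Hk_metric \<gamma>"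
    using assms by (intro has_integral_nonneg[OF has_integral_path_len]) (auto simp: paths_between_def)
  with True show ?thesis by simp
next
  case False
  have "0 \<le> (path_len Hk_metric \<gamma> - norm (Y - X)) * norm (Y - X)"
    by (rule has_integral_nonneg[OF has_integral_cauchy_schwarz_deficit[OF assms]])
      (simp add: norm_cauchy_schwarz)
  with False show ?thesis by (simp add: zero_le_mult_iff)
qed

text \<open>
  If \<open>Y = X\<close>, the quotient below is \<open>0\<close> and the equation says that the path stands still. This case
  is separate because the Cauchy-Schwarz deficit is then zero for every path.
\<close>

lemma velocity_of_shortest_path:
  assumes \<gamma>: "\<gamma> \<in> paths_between S X Y" and len: "path_len Hk_metric \<gamma> = norm (Y - X)"
    and s: "s \<in> {0..1}"
  shows "velocity \<gamma> s = (norm (velocity \<gamma> s) / norm (Y - X)) *\<^sub>R (Y - X)"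
proof -
  have C1: "C1_path \<gamma>" using \<gamma> by (simp add: paths_between_def)
  have vanishes: "f s = 0" if "continuous_on {0..1} f" "\<And>t. 0 \<le> f t" "(f has_integral 0) {0..1}"
    for f :: "real \<Rightarrow> real"
    using has_integral_0_cbox_imp_0[of 0 1 f s] that s by simp
  show ?thesis
  proof (cases "Y = X")
    case True
    have "norm (velocity \<gamma> s) = 0"
      using has_integral_path_len[OF C1] True len
      by (intro vanishes continuous_on_norm continuous_on_velocity C1) auto
    then show ?thesis by simp
  next
    case False
    have "norm (velocity \<gamma> s) * norm (Y - X) - inner (velocity \<gamma> s) (Y - X) = 0"
      using has_integral_cauchy_schwarz_deficit[OF \<gamma>] len
      by (intro vanishes[of "\<lambda>s. norm (velocity \<gamma> s) * norm (Y - X) - inner (velocity \<gamma> s) (Y - X)"]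
          continuous_intros continuous_on_velocity C1) (auto simp: norm_cauchy_schwarz)
    then have "norm (velocity \<gamma> s) *\<^sub>R (Y - X) = norm (Y - X) *\<^sub>R velocity \<gamma> s"
      by (simp add: norm_cauchy_schwarz_eq[symmetric])
    then have "velocity \<gamma> s = inverse (norm (Y - X)) *\<^sub>R (norm (velocity \<gamma> s) *\<^sub>R (Y - X))"
      using False by (simp only: scaleR_scaleR) simp
    then show ?thesis
      by (simp only: scaleR_scaleR divide_inverse mult.commute)
  qed
qed

lemma path_eqI_velocity:
  assumes \<gamma>: "C1_path \<gamma>" and "\<gamma> 0 = \<delta> 0" and s: "s \<in> {0..1}"
    and \<delta>: "\<And>t. t \<in> {0..1} \<Longrightarrow> (\<delta> has_vector_derivative velocity \<gamma> t) (at t within {0..1})"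
  shows "\<gamma> s = \<delta> s"
proof -
  have "\<exists>c. \<forall>t\<in>{0..1}. \<gamma> t - \<delta> t = c"
  proof (rule has_vector_derivative_zero_constant)
    show "((\<lambda>t. \<gamma> t - \<delta> t) has_vector_derivative 0) (at t within {0..1})" if "t \<in> {0..1}" for t
      using has_vector_derivative_diff[OF C1_path_velocity[OF \<gamma> that] \<delta>[OF that]] by simp
  qed auto
  then obtain c where c: "\<And>t. t \<in> {0..1} \<Longrightarrow> \<gamma> t - \<delta> t = c" by blast
  show ?thesis using c[of 0] c[OF s] \<open>\<gamma> 0 = \<delta> 0\<close> by simp
qed

text \<open>
  Constant speed and constant direction give a constant velocity \<open>c d\<close>, and arriving at \<open>Y\<close> at time
  \<open>1\<close> forces \<open>c d = d\<close>.
\<close>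

lemma constant_speed_shortest_path:
  assumes \<gamma>: "\<gamma> \<in> paths_between S X Y" and len: "path_len Hk_metric \<gamma> = norm (Y - X)"
    and speed: "constant_speed Hk_metric \<gamma>" and s: "s \<in> {0..1}"
  shows "\<gamma> s = X + s *\<^sub>R (Y - X)"
proof -
  have C1: "C1_path \<gamma>" and ends: "\<gamma> 0 = X" "\<gamma> 1 = Y"
    using \<gamma> by (auto simp: paths_between_def)
  obtain v where v: "\<And>t. t \<in> {0..1} \<Longrightarrow> norm (velocity \<gamma> t) = v"
    using speed unfolding constant_speed_def speed_Hk_metric by blast
  define w where "w = (v / norm (Y - X)) *\<^sub>R (Y - X)"
  have vel: "velocity \<gamma> t = w" if "t \<in> {0..1}" for t
    using velocity_of_shortest_path[OF \<gamma> len that] v[OF that] by (simp add: w_def)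
  have line: "\<gamma> t = X + t *\<^sub>R w" if "t \<in> {0..1}" for t
  proof (rule path_eqI_velocity[OF C1 _ that])
    show "((\<lambda>t. X + t *\<^sub>R w) has_vector_derivative velocity \<gamma> t) (at t within {0..1})"
      if "t \<in> {0..1}" for t
      unfolding vel[OF that] by (auto intro!: derivative_eq_intros)
  qed (simp add: ends)
  from line[of 1] have "w = Y - X" using ends by (simp add: algebra_simps)
  with line[OF s] show ?thesis by simp
qed

text \<open>
  The parameter of the reparametrization is the coordinate of the path along \<open>d\<close>, normalised so that
  it runs from \<open>0\<close> to \<open>1\<close>.
\<close>

lemma reparametrization_of_segment:
  assumes \<gamma>: "\<gamma> \<in> paths_between S X Y" and len: "path_len Hk_metric \<gamma> = norm (Y - X)"
  shows "reparametrization_of \<gamma> (\<lambda>s. X + s *\<^sub>R (Y - X))"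
proof (cases "Y = X")
  case True
  have "constant_speed Hk_metric \<gamma>"
    using velocity_of_shortest_path[OF \<gamma> len] True
    unfolding constant_speed_def speed_Hk_metric by (intro exI[of _ 0]) simp
  then have "\<gamma> s = X + s *\<^sub>R (Y - X)" if "s \<in> {0..1}" for s
    using constant_speed_shortest_path[OF \<gamma> len] that by blast
  moreover have "C1_path (\<lambda>s. s)"
    unfolding C1_path_def by (intro exI[of _ "\<lambda>_. 1"]) (auto intro!: derivative_eq_intros)
  ultimately show ?thesis
    unfolding reparametrization_of_def
    by (intro exI[of _ "\<lambda>s. s"]) (auto simp: mono_on_def)
next
  case False
  have C1: "C1_path \<gamma>" and ends: "\<gamma> 0 = X" "\<gamma> 1 = Y"
    using \<gamma> by (auto simp: paths_between_def)
  define d where "d = Y - X"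
  define \<theta> where "\<theta> s = inner (\<gamma> s - X) d / (norm d)\<^sup>2" for s
  define \<theta>' where "\<theta>' s = norm (velocity \<gamma> s) / norm d" for s
  have d: "d \<noteq> 0" using False by (simp add: d_def)
  have vel: "velocity \<gamma> s = \<theta>' s *\<^sub>R d" if "s \<in> {0..1}" for s
    using velocity_of_shortest_path[OF \<gamma> len that] by (simp add: \<theta>'_def d_def)
  have \<theta>_deriv: "(\<theta> has_vector_derivative \<theta>' s) (at s within {0..1})" if s: "s \<in> {0..1}" for s
  proof -
    have "bounded_linear (\<lambda>x. inner x d / (norm d)\<^sup>2)"
      by (rule bounded_linear_compose[OF bounded_linear_divide bounded_linear_inner_left])
    moreover have "((\<lambda>s. \<gamma> s - X) has_vector_derivative velocity \<gamma> s) (at s within {0..1})"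
      using has_vector_derivative_diff[OF C1_path_velocity[OF C1 s] has_vector_derivative_const]
      by simp
    ultimately have "((\<lambda>s. inner (\<gamma> s - X) d / (norm d)\<^sup>2) has_vector_derivative
        inner (velocity \<gamma> s) d / (norm d)\<^sup>2) (at s within {0..1})"
      by (rule bounded_linear.has_vector_derivative)
    then show ?thesis
      using d by (simp add: \<theta>_def[abs_def] vel[OF s] power2_norm_eq_inner)
  qed
  have "C1_path \<theta>"
    unfolding C1_path_def
    by (intro exI[of _ \<theta>'] conjI ballI \<theta>_deriv)
      (auto simp: \<theta>'_def[abs_def] d intro!: continuous_intros continuous_on_velocity C1)
  moreover have "mono_on {0..1} \<theta>"
  proof (rule mono_onI)
    fix r s :: real assume rs: "r \<in> {0..1}" "s \<in> {0..1}" "r \<le> s"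
    have "(\<theta>' has_integral \<theta> s - \<theta> r) {r..s}"
      using rs by (intro fundamental_theorem_of_calculus
          has_vector_derivative_within_subset[OF \<theta>_deriv]) auto
    then have "0 \<le> \<theta> s - \<theta> r"
      by (rule has_integral_nonneg) (simp add: \<theta>'_def)
    then show "\<theta> r \<le> \<theta> s" by simp
  qed
  moreover have "\<theta> 0 = 0" "\<theta> 1 = 1"
    using d by (simp_all add: \<theta>_def ends flip: d_def power2_norm_eq_inner)
  moreover have "\<gamma> s = X + \<theta> s *\<^sub>R (Y - X)" if "s \<in> {0..1}" for s
  proof (rule path_eqI_velocity[OF C1 _ that])
    show "\<gamma> 0 = X + \<theta> 0 *\<^sub>R (Y - X)" by (simp add: ends \<open>\<theta> 0 = 0\<close>)
    show "((\<lambda>s. X + \<theta> s *\<^sub>R (Y - X)) has_vector_derivative velocity \<gamma> t) (at t within {0..1})"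
      if t: "t \<in> {0..1}" for t
      using has_vector_derivative_add[OF has_vector_derivative_const[of X]
          bounded_linear.has_vector_derivative[OF bounded_linear_scaleR_left[of d] \<theta>_deriv[OF t]]]
      by (simp add: vel[OF t] d_def)
  qed
  ultimately show ?thesis
    unfolding reparametrization_of_def by blast
qed

lemma velocity_segment:
  "s \<in> {0..1} \<Longrightarrow> velocity (\<lambda>s. X + s *\<^sub>R d) s = d"
  by (rule velocity_eqI) (auto intro!: derivative_eq_intros)

lemma path_len_segment: "path_len Hk_metric (\<lambda>s. X + s *\<^sub>R d) = norm d"
proof -
  have "path_len Hk_metric (\<lambda>s. X + s *\<^sub>R d) = integral {0..1} (\<lambda>s::real. norm d)"
    unfolding path_len_def speed_Hk_metric by (intro integral_cong) (simp add: velocity_segment)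
  then show ?thesis by simp
qed

lemma segment_in_paths_between:
  assumes "closed_segment X Y \<subseteq> S"
  shows "(\<lambda>s. X + s *\<^sub>R (Y - X)) \<in> paths_between S X Y"
proof -
  have "C1_path (\<lambda>s. X + s *\<^sub>R (Y - X))"
    unfolding C1_path_def by (intro exI[of _ "\<lambda>_. Y - X"]) (auto intro!: derivative_eq_intros)
  moreover have "X + s *\<^sub>R (Y - X) \<in> S" if "s \<in> {0..1}" for s
    using assms that by (force simp: closed_segment_def algebra_simps)
  ultimately show ?thesis by (simp add: paths_between_def)
qed

lemma unique_minimal_path_segment:
  assumes "closed_segment X Y \<subseteq> S"
  shows "unique_minimal_path Hk_metric S X Y (\<lambda>s. X + s *\<^sub>R (Y - X))"
proof -
  let ?\<gamma> = "\<lambda>s. X + s *\<^sub>R (Y - X)"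
  note seg = segment_in_paths_between[OF assms]
  have "minimal_path Hk_metric S X Y ?\<gamma>"
    unfolding minimal_path_def by (simp add: seg path_len_segment path_len_ge_norm)
  moreover have "constant_speed Hk_metric ?\<gamma>"
    unfolding constant_speed_def speed_Hk_metric
    by (intro exI[of _ "norm (Y - X)"]) (simp add: velocity_segment)
  moreover have "\<delta> \<in> paths_between S X Y \<and> path_len Hk_metric \<delta> = norm (Y - X)"
    if "minimal_path Hk_metric S X Y \<delta>" for \<delta>
    using that seg path_len_ge_norm[of \<delta> S X Y] path_len_segment[of X "Y - X"]
    unfolding minimal_path_def by force
  ultimately show ?thesis
    unfolding unique_minimal_path_def
    using reparametrization_of_segment constant_speed_shortest_path by blast
qed

lemma path_dist_segment:
  assumes "closed_segment X Y \<subseteq> S"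
  shows "path_dist Hk_metric S X Y = ereal (norm (Y - X))"
  unfolding path_dist_def
proof (rule antisym)
  show "(INF \<gamma>\<in>paths_between S X Y. ereal (path_len Hk_metric \<gamma>)) \<le> ereal (norm (Y - X))"
    by (rule INF_lower2[OF segment_in_paths_between[OF assms]]) (simp add: path_len_segment)
  show "ereal (norm (Y - X)) \<le> (INF \<gamma>\<in>paths_between S X Y. ereal (path_len Hk_metric \<gamma>))"
    by (intro INF_greatest) (simp add: path_len_ge_norm)
qed

section \<open>Geodesics in the space of Anosov fields\<close>

theorem theorem7p3:
  fixes A :: "('a::{t2_space, second_countable_topology}, 'n::finite) chart set"
    and g :: "('a, 'n) metric"
    and k :: nat
    and cls :: "('a, 'n) vfield \<Rightarrow> 'h::{real_inner, complete_space}"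
    and X :: 'h
  assumes "compact (UNIV :: 'a set)"
    and "smooth_atlas A"
    and "riemannian_metric A g"
    and "real k > real CARD('n) / 2 + 1"
    and "Hk_space A g k cls"
    and "open (An_Hk A g k cls)"
    and "X \<in> An_Hk A g k cls"
  shows "\<exists>U. open U \<and> X \<in> U \<and> U \<subseteq> An_Hk A g k cls \<and>
    (\<exists>\<gamma> :: 'h \<Rightarrow> real \<Rightarrow> 'h.
       (\<forall>Y\<in>U.
          unique_minimal_path Hk_metric (An_Hk A g k cls) X Y (\<gamma> Y) \<and>
          (\<forall>s\<in>{0..1}. \<gamma> Y s = X + s *\<^sub>R (Y - X)) \<and>
          path_dist Hk_metric (An_Hk A g k cls) X Y = ereal (path_len Hk_metric (\<gamma> Y)) \<and>
          path_len Hk_metric (\<gamma> Y) = norm (Y - X)) \<and>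
       smooth_on ({0..1} \<times> U) (\<lambda>(s, Y). \<gamma> Y s))"
proof -
  let ?S = "An_Hk A g k cls"
  obtain r where r: "r > 0" "ball X r \<subseteq> ?S"
    using \<open>open ?S\<close> \<open>X \<in> ?S\<close> by (auto simp: open_contains_ball)
  have seg: "closed_segment X Y \<subseteq> ?S" if "Y \<in> ball X r" for Y
    using closed_segment_subset[of X "ball X r" Y] that r by auto
  show ?thesis
    by (intro exI[of _ "ball X r"] conjI exI[of _ "\<lambda>Y s. X + s *\<^sub>R (Y - X)"] ballI)
      (use r seg in \<open>auto simp: unique_minimal_path_segment path_dist_segment path_len_segment
        intro: smooth_on_segment\<close>)
qed

end
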